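(* Let $0<k\le1$ and let $p$ be a complex polynomial of degree $n\ge1$ having all its zeros in $\{|z|\le k\}$, with a zero of order $s$ at the origin; that is, $p(z)=z^sh(z)$ where $h(z)=c_n\prod_{j=1}^{n-s}(z-b_j)=c_s+c_{s+1}z+\dots+c_nz^{n-s}$, $c_n\neq0$, $|b_j|\le k\le 1$ for $j=1,\dots,n-s$. Then for all $z$ with $|z|=1$, $$|p'(z)|\ge\frac{n}{k+1}\left\{1+\frac{sk}{n}+\frac{k}{n}\left(\frac{k^n|c_n|-|c_s|}{k^n|c_n|+|c_s|}\right)\right\}|p(z)|.$$
   Context: Zeros are counted with multiplicity. "Zero of order $s$ at the origin" means exactly order $s$, so the $b_j$ are the nonzero zeros of $p$ and $c_s\ne0$ is the coefficient of $z^s$ in $p$. *)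

theory Defs
  imports Complex_Main "HOL-Computational_Algebra.Polynomial"
begin

end

theory Submission
  imports Defs "HOL-Computational_Algebra.Fundamental_Theorem_Algebra"
begin

text \<open>
  On the unit circle \<open>norm (p' z / p z)\<close> is at least the real part of the logarithmic derivative
  \<open>z p'(z) / p(z)\<close>, to which the zero at the origin contributes \<open>s\<close> and every other zero \<open>b\<close> at
  least \<open>1 / (1 + norm b)\<close>, which exceeds \<open>1 / (1 + k)\<close> by at least
  \<open>k / (1 + k) * ((k - norm b) / (k + norm b))\<close>. Since \<open>f t = (1 - t) / (1 + t)\<close> satisfies
  \<open>f (t * u) \<le> f t + f u\<close> on \<open>[0, 1]\<close>, the excesses add up to at least \<open>k / (1 + k)\<close> times the
  quotient in \<open>k ^ (n - s) * norm c\<^sub>n\<close> and \<open>norm c\<^sub>s\<close>; replacing \<open>k ^ (n - s)\<close> by \<open>k ^ n\<close> only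
  decreases it.
\<close>

text \<open>This is the subadditivity of \<open>f\<close> at \<open>t = B / A\<close> and
  \<open>u = x / K\<close>, in homogeneous form. The sum on the right collapses to
  \<open>2 * (K * A - x * B) / ((A + B) * (K + x))\<close>, and
  \<open>2 * (K * A + x * B) - (A + B) * (K + x)\<close> equals \<open>(A - B) * (K - x)\<close>,
  which is nonnegative.\<close>

lemma diff_over_sum_mult_le:
  fixes A B K x :: real
  assumes "0 < A" "0 \<le> B" "B \<le> A" "0 < K" "0 \<le> x" "x \<le> K"
  shows "(K * A - x * B) / (K * A + x * B) \<le> (A - B) / (A + B) + (K - x) / (K + x)"
proof -
  have pos: "0 < A + B" "0 < K + x" "0 < K * A + x * B"
    using assms by (auto intro: add_pos_nonneg)
  have "x * B \<le> K * A"
    using assms by (intro mult_mono) auto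
  moreover have "(A + B) * (K + x) \<le> 2 * (K * A + x * B)"
    using mult_nonneg_nonneg[of "A - B" "K - x"] assms by (simp add: algebra_simps)
  ultimately have "(K * A - x * B) * ((A + B) * (K + x)) \<le> (K * A - x * B) * (2 * (K * A + x * B))"
    by (intro mult_left_mono) auto
  then have "(K * A - x * B) / (K * A + x * B) \<le> 2 * (K * A - x * B) / ((A + B) * (K + x))"
    using pos_le_divide_eq[OF mult_pos_pos[OF pos(1,2)]]
    by (subst pos_divide_le_eq[OF pos(3)]) (simp add: algebra_simps)
  also have "2 * (K * A - x * B) / ((A + B) * (K + x)) = (A - B) / (A + B) + (K - x) / (K + x)"
    using pos by (simp add: add_frac_eq algebra_simps)
  finally show ?thesis .
qed

lemma Re_divide_diff_ge:
  fixes z a :: complex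
  assumes "norm z = 1" "norm a \<le> 1" "z \<noteq> a"
  shows "1 / (1 + norm a) \<le> Re (z / (z - a))"
proof -
  \<comment> \<open>\<open>u\<close> is the real part of \<open>z * cnj a\<close>; both
    \<open>Re (z / (z - a))\<close> and the bound depend only on \<open>u\<close> and
    \<open>r\<close>. The extremal position is \<open>u = - r\<close>, with \<open>a\<close>
    opposite to \<open>z\<close>.\<close>
  define u where "u = Re z * Re a + Im z * Im a"
  define r where "r = norm a"
  have z: "(Re z)\<^sup>2 + (Im z)\<^sup>2 = 1"
    using assms(1) by (metis cmod_power2 one_power2)
  have a: "(Re a)\<^sup>2 + (Im a)\<^sup>2 = r\<^sup>2"
    by (simp add: r_def cmod_power2)
  have D: "(Re (z - a))\<^sup>2 + (Im (z - a))\<^sup>2 = 1 - 2 * u + r\<^sup>2"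
    using z a by (simp add: u_def power2_eq_square algebra_simps)
  have Dpos: "0 < 1 - 2 * u + r\<^sup>2"
    using assms(3) unfolding D[symmetric] by (auto simp: complex_eq_iff sum_power2_gt_zero_iff)
  have "Re (z / (z - a)) = (1 - u) / (1 - 2 * u + r\<^sup>2)"
    unfolding Re_divide D using z
    by (simp add: u_def power2_eq_square algebra_simps)
  moreover have "\<bar>u\<bar> \<le> r"
    using norm_triangle_ineq abs_Re_le_cmod[of "z * cnj a"] assms(1)
    by (simp add: u_def r_def norm_mult)
  \<comment> \<open>This product is exactly the difference of the two sides once the denominators
    are cleared.\<close>
  then have "0 \<le> (r + u) * (1 - r)"
    using assms(2) by (intro mult_nonneg_nonneg) (auto simp: r_def)
  then have "1 - 2 * u + r\<^sup>2 \<le> (1 - u) * (1 + r)"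
    by (simp add: power2_eq_square algebra_simps)
  moreover have "0 < 1 + r"
    by (simp add: r_def add_pos_nonneg)
  ultimately show ?thesis
    using Dpos by (simp add: r_def[symmetric] divide_le_eq le_divide_eq)
qed

lemma Re_log_deriv_factor_ge:
  fixes z a :: complex
  assumes "0 < k" "k \<le> 1" "norm z = 1" "norm a \<le> k" "z \<noteq> a"
  shows "1 / (k + 1) + k / (k + 1) * ((k - norm a) / (k + norm a)) \<le> Re (z / (z - a))"
proof -
  define r where "r = norm a"
  have r: "0 \<le> r" "r \<le> k" using assms by (auto simp: r_def)
  \<comment> \<open>Here \<open>k \<le> 1\<close> enters: it trades the true excess
    \<open>(k - r) / (1 + r)\<close>, up to the factor \<open>1 / (k + 1)\<close>, for a multiple of
    \<open>f (r / k)\<close>, the form that can be summed over the zeros.\<close>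
  have "k * (1 + r) \<le> k + r"
    using mult_right_mono[of k 1 r] assms r by (simp add: algebra_simps)
  then have "k * (k - r) * (1 + r) \<le> (k - r) * (k + r)"
    using mult_left_mono[of "k * (1 + r)" "k + r" "k - r"] r by (simp add: mult_ac)
  then have "k * (k - r) / (k + r) \<le> (k - r) / (1 + r)"
    using assms(1) r by (simp add: divide_le_eq le_divide_eq field_simps)
  moreover have "1 + (k - r) / (1 + r) = (k + 1) / (1 + r)"
    using r by (simp add: field_simps)
  ultimately have "1 + k * (k - r) / (k + r) \<le> (k + 1) / (1 + r)"
    by linarith
  then have "(1 + k * (k - r) / (k + r)) / (k + 1) \<le> (k + 1) / (1 + r) / (k + 1)"
    using assms(1) by (intro divide_right_mono) auto
  also have "(k + 1) / (1 + r) / (k + 1) = 1 / (1 + r)"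
    using assms(1) by simp
  finally have "1 / (k + 1) + k / (k + 1) * ((k - r) / (k + r)) \<le> 1 / (1 + r)"
    by (simp add: add_divide_distrib mult.commute)
  also have "\<dots> \<le> Re (z / (z - a))"
    using Re_divide_diff_ge[of z a] assms by (simp add: r_def)
  finally show ?thesis by (simp add: r_def)
qed

lemma log_deriv_mult:
  fixes p q :: "'a::field poly"
  assumes "poly p z \<noteq> 0" "poly q z \<noteq> 0"
  shows "poly (pderiv (p * q)) z / poly (p * q) z
       = poly (pderiv p) z / poly p z + poly (pderiv q) z / poly q z"
  using assms by (simp add: pderiv_mult field_simps)

text \<open>Induction splitting off one linear factor at a time. The first conjunct is carried along
  because the subadditivity step needs \<open>B \<le> A\<close> for the remaining factor.\<close>

lemma Re_log_deriv_ge: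
  fixes h :: "complex poly"
  assumes k: "0 < k" "k \<le> 1" and z: "norm z = 1"
    and "\<And>w. poly h w = 0 \<Longrightarrow> norm w \<le> k" and "poly h z \<noteq> 0"
  shows "norm (poly h 0) \<le> k ^ degree h * norm (lead_coeff h) \<and>
    real (degree h) / (k + 1) + k / (k + 1) *
      ((k ^ degree h * norm (lead_coeff h) - norm (poly h 0)) /
       (k ^ degree h * norm (lead_coeff h) + norm (poly h 0)))
    \<le> Re (z * (poly (pderiv h) z / poly h z))"
  using assms(4,5)
proof (induction "degree h" arbitrary: h)
  case 0
  then obtain c where "h = [:c:]"
    by (metis degree_eq_zeroE)
  then show ?case by simp
next
  case (Suc m)
  obtain a where a: "poly h a = 0"
    using fundamental_theorem_of_algebra[of h] Suc.hyps(2) by (auto simp: constant_degree)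
  then obtain q where h: "h = [:-a, 1:] * q"
    by (auto simp: poly_eq_0_iff_dvd elim: dvdE)
  have q0: "poly q z \<noteq> 0" and za: "z \<noteq> a"
    using Suc.prems(2) by (auto simp: h)
  have "q \<noteq> 0" using q0 by auto
  then have deg: "degree h = Suc (degree q)" and lc: "lead_coeff h = lead_coeff q"
    unfolding h by (subst degree_mult_eq lead_coeff_mult; simp)+
  have ak: "norm a \<le> k" using Suc.prems(1) a by blast
  have h0: "norm (poly h 0) = norm a * norm (poly q 0)"
    by (simp add: h norm_mult)
  \<comment> \<open>Restoring the factor with root \<open>a\<close> turns \<open>A\<close> into
    \<open>k * A\<close> and \<open>B\<close> into \<open>norm a * B\<close>, so
    \<open>diff_over_sum_mult_le\<close> applies with \<open>K = k\<close> and
    \<open>x = norm a\<close>.\<close>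
  define A B where "A = k ^ degree q * norm (lead_coeff q)" and "B = norm (poly q 0)"
  have hA: "k ^ degree h * norm (lead_coeff h) = k * A"
    unfolding lc unfolding deg A_def by simp
  have IH: "B \<le> A" "real (degree q) / (k + 1) + k / (k + 1) * ((A - B) / (A + B))
      \<le> Re (z * (poly (pderiv q) z / poly q z))"
    using Suc.hyps(1)[of q] Suc.hyps(2) Suc.prems(1) q0 deg by (auto simp: h A_def B_def)
  have "0 < A" "0 \<le> B"
    using k \<open>q \<noteq> 0\<close> by (auto simp: A_def B_def)
  have "norm (poly h 0) \<le> k ^ degree h * norm (lead_coeff h)"
    unfolding h0 hA using IH(1) ak k by (auto simp: B_def intro: mult_mono)
  moreover have "real (degree h) / (k + 1) + k / (k + 1) *
      ((k * A - norm a * B) / (k * A + norm a * B))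
      \<le> Re (z * (poly (pderiv h) z / poly h z))"
  proof -
    have "real (degree h) / (k + 1) + k / (k + 1) *
        ((k * A - norm a * B) / (k * A + norm a * B))
      \<le> real (degree h) / (k + 1) + k / (k + 1) *
        ((A - B) / (A + B) + (k - norm a) / (k + norm a))"
      using k diff_over_sum_mult_le[OF \<open>0 < A\<close> \<open>0 \<le> B\<close> IH(1) k(1) _ ak]
      by (intro add_left_mono mult_left_mono) auto
    also have "\<dots> = (real (degree q) / (k + 1) + k / (k + 1) * ((A - B) / (A + B)))
        + (1 / (k + 1) + k / (k + 1) * ((k - norm a) / (k + norm a)))"
      by (simp add: deg add_divide_distrib distrib_left)
    also have "\<dots> \<le> Re (z * (poly (pderiv q) z / poly q z)) + Re (z / (z - a))"
      using IH(2) Re_log_deriv_factor_ge[OF k z ak za] by (rule add_mono)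
    also have "\<dots> = Re (z * (poly (pderiv h) z / poly h z))"
      unfolding h using log_deriv_mult[of "[:-a, 1:]" z q] q0 za
      by (simp add: pderiv_pCons distrib_left)
    finally show ?thesis .
  qed
  ultimately show ?case
    unfolding hA h0 B_def by blast
qed

theorem corollary3p4:
  fixes p :: "complex poly" and k :: real and n s :: nat and z :: complex
  assumes "0 < k" and "k \<le> 1"
    and "degree p = n" and "n \<ge> 1"
    and "\<And>w. poly p w = 0 \<Longrightarrow> norm w \<le> k"
    and "order 0 p = s"
    and "norm z = 1"
  shows "norm (poly (pderiv p) z) \<ge>
    real n / (k + 1) *
      (1 + real s * k / real n
         + k / real n * ((k ^ n * norm (coeff p n) - norm (coeff p s)) /
                         (k ^ n * norm (coeff p n) + norm (coeff p s))))
      * norm (poly p z)"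
proof (cases "poly p z = 0")
  case True
  then show ?thesis by simp
next
  case pz: False
  then have "p \<noteq> 0" by auto
  then obtain h where "p = [:-0, 1:] ^ s * h"
    using order_decomp[of p 0] assms(6) by auto
  then have p: "p = monom 1 s * h"
    by (simp add: monom_altdef)
  have "h \<noteq> 0" and hz: "poly h z \<noteq> 0" and z0: "z \<noteq> 0"
    using \<open>p \<noteq> 0\<close> pz assms(7) by (auto simp: p)
  have n: "n = s + degree h"
    using assms(3) \<open>h \<noteq> 0\<close> by (simp add: p degree_mult_eq degree_monom_eq)
  have cs: "coeff p s = poly h 0" and cn: "coeff p n = lead_coeff h"
    by (simp_all add: p n coeff_monom_mult poly_0_coeff_0)
  define A A' B where "A = k ^ degree h * norm (lead_coeff h)"
    and "A' = k ^ n * norm (lead_coeff h)" and "B = norm (poly h 0)"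
  have "k ^ n \<le> k ^ degree h"
    using assms(1,2) by (intro power_decreasing) (auto simp: n)
  then have "A' \<le> A" "0 < A'" "0 \<le> B"
    using assms(1) \<open>h \<noteq> 0\<close> by (auto simp: A_def A'_def B_def intro: mult_right_mono)
  \<comment> \<open>Cross-multiplied, the comparison of the two quotients reduces to this
    inequality.\<close>
  then have "A' * B \<le> A * B"
    by (intro mult_right_mono)
  then have ratio: "(A' - B) / (A' + B) \<le> (A - B) / (A + B)"
    using \<open>A' \<le> A\<close> \<open>0 < A'\<close> \<open>0 \<le> B\<close> by (simp add: divide_le_eq le_divide_eq field_simps)
  have "real n * (1 + real s * k / real n + k / real n * R) = real n + real s * k + k * R" for R
    using assms(4) by (simp add: field_simps)
  then have "real n / (k + 1) * (1 + real s * k / real n + k / real n * ((A' - B) / (A' + B)))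
      = (real n + real s * k) / (k + 1) + k / (k + 1) * ((A' - B) / (A' + B))"
    by (simp only: times_divide_eq_left add_divide_distrib)
  also have "\<dots> \<le> (real n + real s * k) / (k + 1) + k / (k + 1) * ((A - B) / (A + B))"
    using ratio assms(1) by (intro add_left_mono mult_left_mono) auto
  \<comment> \<open>The term \<open>s * k\<close> raises the share of each zero at the origin from
    \<open>1 / (k + 1)\<close> to its full contribution 1.\<close>
  also have "real n + real s * k = real s * (k + 1) + real (degree h)"
    by (simp add: n algebra_simps)
  also have "(real s * (k + 1) + real (degree h)) / (k + 1) + k / (k + 1) * ((A - B) / (A + B))
      = real s + (real (degree h) / (k + 1) + k / (k + 1) * ((A - B) / (A + B)))"
    using assms(1) by (simp add: add_divide_distrib)
  also have "\<dots> \<le> real s + Re (z * (poly (pderiv h) z / poly h z))"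
    using Re_log_deriv_ge[OF assms(1,2,7) _ hz] assms(5) by (simp add: A_def B_def p)
  also have "\<dots> = Re (z * (poly (pderiv p) z / poly p z))"
  proof -
    have "z * (poly (pderiv (monom 1 s)) z / poly (monom 1 s) z) = of_nat s"
      \<comment> \<open>The case split deals with the truncated exponent \<open>s - 1\<close> at
        \<open>s = 0\<close>.\<close>
      using z0 by (cases s) (simp_all add: pderiv_monom poly_monom)
    then show ?thesis
      unfolding p using log_deriv_mult[of "monom 1 s" z h] hz z0
      by (simp add: poly_monom distrib_left)
  qed
  also have "\<dots> \<le> norm (z * (poly (pderiv p) z / poly p z))"
    by (rule complex_Re_le_cmod)
  also have "\<dots> = norm (poly (pderiv p) z) / norm (poly p z)"
    by (simp add: norm_mult norm_divide assms(7))
  finally show ?thesis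
    using pz by (simp add: le_divide_eq cs cn A'_def B_def)
qed

end
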